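(* Let $F:\mathbb{R}^n\rightrightarrows\mathbb{R}^n$ be a multifunction satisfying (F1)-(F3) of the context, with bilateral minimal time function $T$ and Hamiltonian $h$. Then for every $\alpha\in\mathbb{R}^n$, $$\widehat{\partial}T(\alpha,\alpha)=\{(\zeta,-\zeta)\in\mathbb{R}^n\times\mathbb{R}^n: h(\alpha,\zeta)\ge -1\}.$$
   Context: $\|\cdot\|$ and $\langle\cdot,\cdot\rangle$ denote the Euclidean norm and inner product (also on product spaces), and $\bar B$ the closed unit ball of $\mathbb{R}^n$. Assumptions on $F:\mathbb{R}^n\rightrightarrows\mathbb{R}^n$: (F1) $F(x)$ is nonempty, compact and convex for every $x\in\mathbb{R}^n$. (F2) $F$ is locally Lipschitz: for every compact set $K\subset\mathbb{R}^n$ there is a constant $L=L(K)$ such that $F(x)\subset F(y)+L\|y-x\|\bar B$ for all $x,y\in K$. (F3) There are positive constants $\gamma,c$ such that for all $x\in\mathbb{R}^n$, $v\in F(x)$ implies $\|v\|\le\gamma\|x\|+c$. A trajectory of $F$ is an absolutely continuous function $x(\cdot)$ with $\dot x(t)\in F(x(t))$ for a.e. $t$ in its interval of definition. The bilateral minimal time function $T:\mathbb{R}^n\times\mathbb{R}^n\to[0,+\infty]$ is $T(\alpha,\beta)=\inf\{\tau\ge 0:\text{ there is a trajectory }x(\cdot)\text{ of }F\text{ on }[0,\tau]\text{ with }x(0)=\alpha,\ x(\tau)=\beta\}$, with $T(\alpha,\beta)=+\infty$ if there is no such trajectory; in particular $T(\alpha,\alpha)=0$. The Hamiltonian is $h(x,p)=\min_{v\in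 F(x)}\langle v,p\rangle$ for $(x,p)\in\mathbb{R}^n\times\mathbb{R}^n$. For $f:\mathbb{R}^m\to\mathbb{R}\cup\{+\infty\}$ and $x$ with $f(x)<+\infty$, the Fréchet subdifferential is $\widehat{\partial}f(x)=\left\{\zeta\in\mathbb{R}^m:\liminf_{y\to x}\frac{f(y)-f(x)-\langle\zeta,y-x\rangle}{\|y-x\|}\ge 0\right\}$. *)

theory Defs
  imports "HOL-Analysis.Analysis"
begin

definition F1 :: "('a::euclidean_space \<Rightarrow> 'a set) \<Rightarrow> bool" where
  "F1 F \<longleftrightarrow> (\<forall>x. F x \<noteq> {} \<and> compact (F x) \<and> convex (F x))"

text \<open>The sum of sets below is the Minkowski sum.\<close>

definition F2 :: "('a::euclidean_space \<Rightarrow> 'a set) \<Rightarrow> bool" where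
  "F2 F \<longleftrightarrow> (\<forall>K. compact K \<longrightarrow>
     (\<exists>L::real. \<forall>x\<in>K. \<forall>y\<in>K. F x \<subseteq> F y + (\<lambda>b. (L * norm (y - x)) *\<^sub>R b) ` cball 0 1))"

definition F3 :: "('a::euclidean_space \<Rightarrow> 'a set) \<Rightarrow> bool" where
  "F3 F \<longleftrightarrow> (\<exists>\<gamma>>0. \<exists>c>0. \<forall>x. \<forall>v\<in>F x. norm v \<le> \<gamma> * norm x + c)"

text \<open>Absolute continuity of a function on an interval; a finite family of non-overlapping
  subintervals is given by the set \<open>D\<close> of the pairs of their end points.\<close>

definition abs_continuous_on :: "real set \<Rightarrow> (real \<Rightarrow> 'a::real_normed_vector) \<Rightarrow> bool" where
  "abs_continuous_on I f \<longleftrightarrow>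
     (\<forall>\<epsilon>>0. \<exists>\<delta>>0. \<forall>D. finite D \<and> (\<forall>(a, b)\<in>D. a \<le> b \<and> {a..b} \<subseteq> I) \<and>
        disjoint_family_on (\<lambda>(a, b). {a<..<b}) D \<and> (\<Sum>(a, b)\<in>D. b - a) < \<delta> \<longrightarrow>
        (\<Sum>(a, b)\<in>D. norm (f b - f a)) < \<epsilon>)"

definition trajectory_on :: "('a::euclidean_space \<Rightarrow> 'a set) \<Rightarrow> real set \<Rightarrow> (real \<Rightarrow> 'a) \<Rightarrow> bool" where
  "trajectory_on F I x \<longleftrightarrow> abs_continuous_on I x \<and>
     (AE t in lebesgue_on I. \<exists>v\<in>F (x t). (x has_vector_derivative v) (at t within I))"

text \<open>The infimum is taken in the extended reals, where the infimum of the empty set is \<open>\<infinity>\<close>.\<close>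

definition min_time :: "('a::euclidean_space \<Rightarrow> 'a set) \<Rightarrow> 'a \<times> 'a \<Rightarrow> ereal" where
  "min_time F = (\<lambda>(\<alpha>, \<beta>).
     Inf {ereal \<tau> | \<tau>. 0 \<le> \<tau> \<and> (\<exists>x. trajectory_on F {0..\<tau>} x \<and> x 0 = \<alpha> \<and> x \<tau> = \<beta>)})"

lemma min_time_nonneg: "0 \<le> min_time F z"
  by (auto simp: min_time_def intro!: Inf_greatest split: prod.split)

lemma min_time_diag: "min_time F (\<alpha>, \<alpha>) = 0"
proof -
  have z: "(\<Sum>(a, b)\<in>D. norm ((\<lambda>_. \<alpha>) b - (\<lambda>_. \<alpha>) a)) = 0" for D :: "(real \<times> real) set"
    by (intro sum.neutral) auto
  have "abs_continuous_on {0..0} (\<lambda>_. \<alpha>)"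
    unfolding abs_continuous_on_def z by (auto intro: exI[of _ 1])
  moreover have "AE t in lebesgue_on {0..0::real}.
      \<exists>v\<in>F \<alpha>. ((\<lambda>_. \<alpha>) has_vector_derivative v) (at t within {0..0})"
  proof -
    have "AE t in lebesgue. t \<noteq> (0::real)"
      by (intro AE_completion AE_lborel_singleton)
    then show ?thesis
      by (subst AE_restrict_space_iff) (auto elim!: eventually_mono simp del: atLeastAtMost_singleton)
  qed
  ultimately have "trajectory_on F {0..0} (\<lambda>_. \<alpha>)"
    unfolding trajectory_on_def by blast
  then have "min_time F (\<alpha>, \<alpha>) \<le> ereal 0"
    unfolding min_time_def prod.case by (intro Inf_lower CollectI exI[of _ 0]) auto
  with min_time_nonneg[of F "(\<alpha>, \<alpha>)"] show ?thesis
    by (simp add: zero_ereal_def antisym)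
qed

text \<open>The least element of the set of values, i.e. their minimum, which exists under \<open>F1\<close>
  (see below).\<close>

definition hamiltonian :: "('a::euclidean_space \<Rightarrow> 'a set) \<Rightarrow> 'a \<Rightarrow> 'a \<Rightarrow> real" where
  "hamiltonian F x p = (LEAST r. r \<in> (\<lambda>v. v \<bullet> p) ` F x)"

lemma hamiltonian_attained:
  assumes "F1 F"
  shows "\<exists>v\<in>F x. hamiltonian F x p = v \<bullet> p \<and> (\<forall>w\<in>F x. v \<bullet> p \<le> w \<bullet> p)"
proof -
  have "\<exists>v\<in>F x. \<forall>w\<in>F x. v \<bullet> p \<le> w \<bullet> p"
    using assms by (intro continuous_attains_inf continuous_intros) (auto simp: F1_def)
  then obtain v where v: "v \<in> F x" "\<forall>w\<in>F x. v \<bullet> p \<le> w \<bullet> p"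
    by blast
  then have "hamiltonian F x p = v \<bullet> p"
    unfolding hamiltonian_def by (intro Least_equality) auto
  with v show ?thesis
    by blast
qed

text \<open>Meant for functions without the value \<open>-\<infinity>\<close>; empty outside the effective domain.\<close>

definition frechet_subdifferential :: "('a::euclidean_space \<Rightarrow> ereal) \<Rightarrow> 'a \<Rightarrow> 'a set" where
  "frechet_subdifferential f x = {\<zeta>. f x < \<infinity> \<and>
     0 \<le> Liminf (at x) (\<lambda>y. (f y - f x - ereal (\<zeta> \<bullet> (y - x))) / ereal (norm (y - x)))}"

end

theory Submission
  imports Defs
begin

text \<open>
  A subgradient \<open>(\<zeta>, \<eta>)\<close> is tested along the diagonal, where \<open>T\<close> vanishes, which forces
  \<open>\<eta> = - \<zeta>\<close>, and along the points \<open>(\<alpha>, x t)\<close> of a trajectory with \<open>x 0 = \<alpha>\<close> and \<open>x' 0 = v\<close>, where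
  \<open>T \<le> t\<close>, which forces \<open>\<langle>v, \<zeta>\<rangle> \<ge> - 1\<close>. Such a trajectory exists for every \<open>v \<in> F \<alpha>\<close> by Filippov's
  successive approximations.

  Conversely, let \<open>h(\<alpha>, \<zeta>) \<ge> - 1\<close>, let a trajectory lead from \<open>y\<close> to \<open>z\<close> in time \<open>\<tau>\<close>, and let \<open>r\<close> be the
  distance of \<open>(y, z)\<close> from \<open>(\<alpha>, \<alpha>)\<close>. If \<open>\<tau>\<close> exceeds a fixed multiple of \<open>r\<close>, then
  \<open>\<langle>\<zeta>, y - z\<rangle> \<le> \<tau>\<close> by Cauchy-Schwarz. Otherwise the trajectory stays close to \<open>\<alpha>\<close>, where
  \<open>\<langle>\<zeta>, x'\<rangle> \<ge> - 1 - o(1)\<close> by the Lipschitz property, and integration gives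
  \<open>\<langle>\<zeta>, y - z\<rangle> \<le> \<tau> + o(r)\<close>.
\<close>

section \<open>Absolute continuity and increments controlled by the a.e. derivative\<close>

lemma abs_continuous_on_subset:
  "abs_continuous_on I f \<Longrightarrow> J \<subseteq> I \<Longrightarrow> abs_continuous_on J f"
  unfolding abs_continuous_on_def
  by (elim all_forward imp_forward ex_forward conj_forward) (fastforce split: prod.splits)+

text \<open>Gauges deliver tagged divisions, while absolute continuity speaks of sets of end point
  pairs; sending \<open>(t, K)\<close> to \<open>(Inf K, Sup K)\<close> translates between the
  two.\<close>

lemma abs_continuous_on_tagged_division:
  assumes "abs_continuous_on {a..b} f" and "\<epsilon> > 0"
  obtains \<delta> where "\<delta> > 0"
    "\<And>p. p tagged_partial_division_of {a..b} \<Longrightarrow> (\<Sum>(t, K)\<in>p. measure lborel K) < \<delta>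
       \<Longrightarrow> (\<Sum>(t, K)\<in>p. norm (f (Sup K) - f (Inf K))) < \<epsilon>"
proof -
  obtain \<delta> where "\<delta> > 0" and \<delta>: "\<forall>D. finite D \<and> (\<forall>(u, v)\<in>D. u \<le> v \<and> {u..v} \<subseteq> {a..b}) \<and>
        disjoint_family_on (\<lambda>(u, v). {u<..<v}) D \<and> (\<Sum>(u, v)\<in>D. v - u) < \<delta> \<longrightarrow>
        (\<Sum>(u, v)\<in>D. norm (f v - f u)) < \<epsilon>"
    using assms(1)[unfolded abs_continuous_on_def, rule_format, OF \<open>\<epsilon> > 0\<close>] by (elim exE conjE)
  show thesis
  proof
    show "\<delta> > 0" by fact
    fix p assume p: "p tagged_partial_division_of {a..b}" and lt: "(\<Sum>(t, K)\<in>p. measure lborel K) < \<delta>"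
    note pD = tagged_partial_division_ofD[OF p]
    let ?e = "\<lambda>(t::real, K::real set). (Inf K, Sup K)"
    have K: "\<exists>u v. K = {u..v} \<and> u \<le> v \<and> Inf K = u \<and> Sup K = v" if "(t, K) \<in> p" for t K
      using pD(2)[OF that] pD(4)[OF that] by (force simp: cbox_interval)
    \<comment> \<open>A set of pairs would merge two tagged intervals with the same end points. If
      one interval carried two tags, its interior would be empty, so it would be a single point and
      both tags would be that point.\<close>
    have inj: "inj_on ?e p"
    proof (rule inj_onI, clarify)
      fix t K t' K' assume tK: "(t, K) \<in> p" "(t', K') \<in> p" and eq: "Inf K = Inf K'" "Sup K = Sup K'"
      then obtain u v where uv: "K = {u..v}" "K' = {u..v}" "u \<le> v" by (metis K)
      show "t = t' \<and> K = K'"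
      proof (rule ccontr)
        assume "\<not> ?thesis"
        then have "interior K \<inter> interior K' = {}" using pD(5)[OF tK] by auto
        then have "u = v" using uv by (auto simp: interior_atLeastAtMost_real)
        with \<open>\<not> ?thesis\<close> show False using pD(2)[OF tK(1)] pD(2)[OF tK(2)] uv by auto
      qed
    qed
    have "(\<Sum>(u, v)\<in>?e ` p. norm (f v - f u)) < \<epsilon>"
    proof (rule \<delta>[rule_format], intro conjI)
      show "finite (?e ` p)" using pD(1) by simp
      show "\<forall>(u, v)\<in>?e ` p. u \<le> v \<and> {u..v} \<subseteq> {a..b}"
        using K pD(3) by (fastforce split: prod.splits)
      show "disjoint_family_on (\<lambda>(u, v). {u<..<v}) (?e ` p)"
        unfolding disjoint_family_on_def
      proof (intro ballI impI)
        fix z z' assume "z \<in> ?e ` p" "z' \<in> ?e ` p" "z \<noteq> z'"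
        then obtain t K t' K' where tK: "(t, K) \<in> p" "(t', K') \<in> p" "K \<noteq> K'"
          and z: "z = (Inf K, Sup K)" "z' = (Inf K', Sup K')"
          by auto
        then have "interior K \<inter> interior K' = {}" using pD(5)[OF tK(1,2)] by auto
        then have "{Inf K<..<Sup K} \<inter> {Inf K'<..<Sup K'} = {}"
          using K[OF tK(1)] K[OF tK(2)] by (metis interior_atLeastAtMost_real)
        then show "(case z of (u, v) \<Rightarrow> {u<..<v}) \<inter> (case z' of (u, v) \<Rightarrow> {u<..<v}) = {}"
          unfolding z prod.case .
      qed
      have "(\<Sum>(u, v)\<in>?e ` p. v - u) = (\<Sum>(t, K)\<in>p. measure lborel K)"
        unfolding sum.reindex[OF inj] by (rule sum.cong) (auto dest!: K)
      with lt show "(\<Sum>(u, v)\<in>?e ` p. v - u) < \<delta>" by simp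
    qed
    then show "(\<Sum>(t, K)\<in>p. norm (f (Sup K) - f (Inf K))) < \<epsilon>"
      unfolding sum.reindex[OF inj] by (simp add: o_def case_prod_unfold)
  qed
qed

text \<open>On a tagged division fine for the a.e. derivative, the intervals tagged in the exceptional null
  set have small total length, so absolute continuity makes their contribution negligible.\<close>

lemma abs_continuous_inner_increment_ge:
  fixes x :: "real \<Rightarrow> 'a::euclidean_space"
  assumes "a \<le> b" and ac: "abs_continuous_on {a..b} x"
    and ae: "AE t in lebesgue_on {a..b}. \<exists>v. (x has_vector_derivative v) (at t within {a..b}) \<and> c \<le> v \<bullet> q"
  shows "c * (b - a) \<le> (x b - x a) \<bullet> q"
proof -
  define N where
    "N = {t \<in> {a..b}. \<not> (\<exists>v. (x has_vector_derivative v) (at t within {a..b}) \<and> c \<le> v \<bullet> q)}"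
  have "AE t in lebesgue. t \<notin> N"
    using ae by (subst (asm) AE_restrict_space_iff) (auto simp: N_def elim!: eventually_mono)
  then have "negligible N"
    by (auto simp: negligible_iff_null_sets eventually_ae_filter intro: null_sets_completion_subset)
  \<comment> \<open>The error has three sources: \<open>e * (b - a)\<close> from the intervals with
    good tags, \<open>e * norm q\<close> from the increments of \<open>x\<close> over the intervals
    tagged in \<open>N\<close>, and \<open>e * \<bar>c\<bar>\<close> from the total length of the
    latter.\<close>
  have "c * (b - a) \<le> (x b - x a) \<bullet> q + e * (b - a + norm q + \<bar>c\<bar>)" if "e > 0" for e
  proof -
    obtain \<delta> where "\<delta> > 0" and \<delta>:
      "\<And>p. p tagged_partial_division_of {a..b} \<Longrightarrow> (\<Sum>(t, K)\<in>p. measure lborel K) < \<delta>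
         \<Longrightarrow> (\<Sum>(t, K)\<in>p. norm (x (Sup K) - x (Inf K))) < e"
      by (rule abs_continuous_on_tagged_division[OF ac \<open>e > 0\<close>]) blast
    \<comment> \<open>A Riemann sum of the indicator of \<open>N\<close> is the total length of the
      intervals tagged in \<open>N\<close>. A gauge for its vanishing integral therefore makes this
      length less than both \<open>\<delta>\<close> and \<open>e\<close>.\<close>
    have "(indicat_real N has_integral 0) {a..b}"
      using \<open>negligible N\<close> unfolding negligible_def by (metis box_real(2))
    then obtain g1 where g1: "gauge g1" "\<And>D. D tagged_division_of {a..b} \<Longrightarrow> g1 fine D \<Longrightarrow>
        norm ((\<Sum>(t, K)\<in>D. measure lborel K *\<^sub>R indicat_real N t) - 0) < min \<delta> e"
      unfolding has_integral_real using \<open>\<delta> > 0\<close> \<open>e > 0\<close> by (metis min_less_iff_conj)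
    \<comment> \<open>At a good tag the linear approximation errs by at most
      \<open>e * (t - u)\<close> on the left and \<open>e * (v - t)\<close> on the right; as the tag
      lies between \<open>u\<close> and \<open>v\<close>, these add up to
      \<open>e * (v - u)\<close>.\<close>
    have "\<exists>d>0. t \<in> {a..b} - N \<longrightarrow> (\<forall>u v. {u..v} \<subseteq> {a..b} \<and> {u..v} \<subseteq> ball t d \<and> u \<le> t \<and> t \<le> v \<longrightarrow>
        c * (v - u) - e * (v - u) \<le> (x v - x u) \<bullet> q)" for t
    proof (cases "t \<in> {a..b} - N")
      case True
      then obtain w where w: "(x has_vector_derivative w) (at t within {a..b})" "c \<le> w \<bullet> q"
        unfolding N_def by blast
      have "((\<lambda>s. x s \<bullet> q) has_vector_derivative (w \<bullet> q)) (at t within {a..b})"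
        using bounded_linear.has_vector_derivative[OF bounded_linear_inner_left w(1)] .
      then obtain d where "d > 0" and d: "\<And>s. s \<in> {a..b} \<Longrightarrow> norm (s - t) < d \<Longrightarrow>
          norm (x s \<bullet> q - x t \<bullet> q - (s - t) * (w \<bullet> q)) \<le> e * norm (s - t)"
        using \<open>e > 0\<close> unfolding has_vector_derivative_def has_derivative_within_alt
        by (auto simp: real_scaleR_def)
      show ?thesis
      proof (intro exI[of _ d] conjI impI allI \<open>d > 0\<close>)
        fix u v assume uv: "{u..v} \<subseteq> {a..b} \<and> {u..v} \<subseteq> ball t d \<and> u \<le> t \<and> t \<le> v"
        then have "u \<in> {u..v}" "v \<in> {u..v}" by auto
        with uv have "u \<in> {a..b}" "v \<in> {a..b}" "u \<in> ball t d" "v \<in> ball t d"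
          by blast+
        then have mem: "u \<in> {a..b}" "v \<in> {a..b}" "norm (u - t) < d" "norm (v - t) < d"
          by (auto simp: dist_norm norm_minus_commute)
        have "x u \<bullet> q - x t \<bullet> q - (u - t) * (w \<bullet> q) \<le> e * (t - u)"
             "- (x v \<bullet> q - x t \<bullet> q - (v - t) * (w \<bullet> q)) \<le> e * (v - t)"
          using d[OF mem(1,3)] d[OF mem(2,4)] uv unfolding real_norm_def by auto
        then have "(v - u) * (w \<bullet> q) - e * (v - u) \<le> (x v - x u) \<bullet> q"
          by (simp add: algebra_simps inner_diff_left)
        moreover have "c * (v - u) \<le> (v - u) * (w \<bullet> q)"
          using mult_right_mono[OF w(2), of "v - u"] uv by (simp add: mult.commute)
        ultimately show "c * (v - u) - e * (v - u) \<le> (x v - x u) \<bullet> q" by linarith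
      qed
    qed (auto intro: exI[of _ 1])
    then obtain d where d: "\<And>t. d t > (0::real)" "\<And>t u v. t \<in> {a..b} - N \<Longrightarrow> {u..v} \<subseteq> {a..b} \<Longrightarrow>
        {u..v} \<subseteq> ball t (d t) \<Longrightarrow> u \<le> t \<Longrightarrow> t \<le> v \<Longrightarrow> c * (v - u) - e * (v - u) \<le> (x v - x u) \<bullet> q"
      by metis
    have "gauge (\<lambda>t. g1 t \<inter> ball t (d t))"
      using g1(1) d(1) by (intro gauge_Int) (auto simp: gauge_def)
    then obtain p where p: "p tagged_division_of {a..b}" and "(\<lambda>t. g1 t \<inter> ball t (d t)) fine p"
      using fine_division_exists_real by blast
    then have fine: "g1 fine p" "(\<lambda>t. ball t (d t)) fine p"
      by (auto simp: fine_Int)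
    note pD = tagged_division_ofD[OF p]
    define P where "P = {(t, K) \<in> p. t \<in> N}"
    have P: "P \<subseteq> p" "finite P" "finite p" "P tagged_partial_division_of {a..b}"
      using pD(1) tagged_partial_division_subset[of p "{a..b}" P] p
      by (auto simp: P_def tagged_division_of_def intro: finite_subset)
    have K: "\<exists>u v. K = {u..v} \<and> u \<le> v \<and> u \<le> t \<and> t \<le> v \<and> Inf K = u \<and> Sup K = v \<and> measure lborel K = v - u"
      if "(t, K) \<in> p" for t K
      using pD(2)[OF that] pD(4)[OF that] by (force simp: cbox_interval)
    have "(\<Sum>(t, K)\<in>p. measure lborel K *\<^sub>R indicat_real N t) = (\<Sum>(t, K)\<in>P. measure lborel K)"
      using P by (intro sum.mono_neutral_cong_right) (auto simp: P_def indicator_def split: if_splits)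
    with g1(2)[OF p fine(1)] have len: "(\<Sum>(t, K)\<in>P. measure lborel K) < \<delta>" "(\<Sum>(t, K)\<in>P. measure lborel K) < e"
      by auto
    have incr: "(\<Sum>(t, K)\<in>P. norm (x (Sup K) - x (Inf K))) < e"
      using \<delta>[OF P(4) len(1)] .
    let ?h = "\<lambda>(t, K). (x (Sup K) - x (Inf K)) \<bullet> q - c * (Sup K - Inf K)"
    have tot: "(\<Sum>(t, K)\<in>p. Sup K - Inf K) = b - a"
      using additive_tagged_division_1[OF \<open>a \<le> b\<close> p, of "\<lambda>x. x"] .
    have "(x b - x a) \<bullet> q - c * (b - a) = sum ?h p"
      using additive_tagged_division_1[OF \<open>a \<le> b\<close> p, of "\<lambda>t. x t \<bullet> q - c * t"]
      by (simp add: algebra_simps inner_diff_left case_prod_unfold)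
    also have "\<dots> = sum ?h (p - P) + sum ?h P"
      using P by (simp add: sum.subset_diff)
    also have "\<dots> \<ge> - e * (b - a) + - (e * (norm q + \<bar>c\<bar>))"
    proof (rule add_mono)
      have "- e * (b - a) \<le> - e * (\<Sum>(t, K)\<in>p - P. Sup K - Inf K)"
        unfolding tot[symmetric] using \<open>e > 0\<close> P K
        by (simp, intro sum_mono2) (fastforce)+
      also have "\<dots> = (\<Sum>(t, K)\<in>p - P. - e * (Sup K - Inf K))"
        by (simp add: sum_distrib_left case_prod_unfold)
      also have "\<dots> \<le> sum ?h (p - P)"
      proof (rule sum_mono, clarify)
        fix t K assume tK: "(t, K) \<in> p" "(t, K) \<notin> P"
        then obtain u v where uv: "K = {u..v}" "u \<le> v" "u \<le> t" "t \<le> v" "Inf K = u" "Sup K = v"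
          using K by blast
        have "c * (v - u) - e * (v - u) \<le> (x v - x u) \<bullet> q"
        proof (rule d(2))
          show "t \<in> {a..b} - N" using tK pD(2,3)[OF tK(1)] by (auto simp: P_def)
          show "{u..v} \<subseteq> {a..b}" using pD(3)[OF tK(1)] uv by simp
          show "{u..v} \<subseteq> ball t (d t)" using fine(2) tK(1) uv by (auto simp: fine_def)
        qed (use uv in auto)
        then show "- e * (Sup K - Inf K) \<le> (x (Sup K) - x (Inf K)) \<bullet> q - c * (Sup K - Inf K)"
          using uv by simp
      qed
      finally show "- e * (b - a) \<le> sum ?h (p - P)" .
      have "- (norm q * (\<Sum>(t, K)\<in>P. norm (x (Sup K) - x (Inf K))) + \<bar>c\<bar> * (\<Sum>(t, K)\<in>P. measure lborel K))
          = (\<Sum>(t, K)\<in>P. - (norm q * norm (x (Sup K) - x (Inf K))) - \<bar>c\<bar> * measure lborel K)"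
        by (simp add: sum_distrib_left case_prod_unfold sum_subtractf sum_negf)
      also have "\<dots> \<le> sum ?h P"
      proof (rule sum_mono, clarify)
        fix t K assume tK: "(t, K) \<in> P"
        then obtain u v where uv: "u \<le> v" "Inf K = u" "Sup K = v" "measure lborel K = v - u"
          using K P(1) by blast
        have "\<bar>(x v - x u) \<bullet> q\<bar> \<le> norm q * norm (x v - x u)"
          using Cauchy_Schwarz_ineq2[of "x v - x u" q] by (simp add: mult.commute)
        moreover have "c * (v - u) \<le> \<bar>c\<bar> * (v - u)"
          using uv by (intro mult_right_mono) auto
        ultimately show "- (norm q * norm (x (Sup K) - x (Inf K))) - \<bar>c\<bar> * measure lborel K
            \<le> (x (Sup K) - x (Inf K)) \<bullet> q - c * (Sup K - Inf K)"
          using uv by auto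
      qed
      finally have "- (norm q * (\<Sum>(t, K)\<in>P. norm (x (Sup K) - x (Inf K))) + \<bar>c\<bar> * (\<Sum>(t, K)\<in>P. measure lborel K))
        \<le> sum ?h P" .
      moreover have "norm q * (\<Sum>(t, K)\<in>P. norm (x (Sup K) - x (Inf K))) \<le> norm q * e"
        "\<bar>c\<bar> * (\<Sum>(t, K)\<in>P. measure lborel K) \<le> \<bar>c\<bar> * e"
        using incr len by (auto intro!: mult_left_mono)
      ultimately show "- (e * (norm q + \<bar>c\<bar>)) \<le> sum ?h P"
        by (simp add: algebra_simps)
    qed
    finally show ?thesis by (simp add: algebra_simps)
  qed
  note bound = this
  \<comment> \<open>The summand 1 keeps \<open>B\<close> positive when all other terms vanish, so
    that \<open>bound\<close> can be applied to \<open>e / B\<close>.\<close>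
  define B where "B = b - a + norm q + \<bar>c\<bar> + 1"
  have B: "B > 0" using \<open>a \<le> b\<close> by (simp add: B_def add_nonneg_pos)
  have "c * (b - a) \<le> (x b - x a) \<bullet> q + e" if "e > 0" for e
  proof -
    have "e / B * (b - a + norm q + \<bar>c\<bar>) \<le> e / B * B"
      using that B by (intro mult_left_mono) (auto simp: B_def)
    then show ?thesis using bound[of "e / B"] that B by simp
  qed
  then show ?thesis by (rule field_le_epsilon)
qed

section \<open>The multifunction on compact sets and projections onto its values\<close>

lemma F2_compact:
  assumes "F2 F" and "compact K"
  obtains L where "L > 0"
    "\<And>x y u. x \<in> K \<Longrightarrow> y \<in> K \<Longrightarrow> u \<in> F x \<Longrightarrow> \<exists>w\<in>F y. dist u w \<le> L * dist x y"
proof -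
  obtain L where L: "\<forall>x\<in>K. \<forall>y\<in>K. F x \<subseteq> F y + (\<lambda>b. (L * norm (y - x)) *\<^sub>R b) ` cball 0 1"
    using assms(1)[unfolded F2_def, rule_format, OF assms(2)] by (elim exE)
  show thesis
  proof
    \<comment> \<open>\<open>F2\<close> leaves the sign of \<open>L\<close> open; the unit ball is
      symmetric, so \<open>\<bar>L\<bar>\<close> serves as well, and adding 1 makes the constant
      positive.\<close>
    show "\<bar>L\<bar> + 1 > 0" by simp
    fix x y u assume "x \<in> K" "y \<in> K" "u \<in> F x"
    then have "u \<in> F y + (\<lambda>b. (L * norm (y - x)) *\<^sub>R b) ` cball 0 1"
      using L by blast
    then obtain w b where w: "w \<in> F y" "u = w + (L * norm (y - x)) *\<^sub>R b" "norm b \<le> 1"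
      by (elim set_plus_elim imageE) auto
    have "dist u w = (\<bar>L\<bar> * dist x y) * norm b"
      using w by (simp add: dist_norm abs_mult norm_minus_commute)
    also have "\<dots> \<le> (\<bar>L\<bar> * dist x y) * 1"
      using w(3) by (intro mult_left_mono) auto
    also have "\<dots> \<le> (\<bar>L\<bar> + 1) * dist x y"
      by (simp add: algebra_simps)
    finally show "\<exists>w\<in>F y. dist u w \<le> (\<bar>L\<bar> + 1) * dist x y"
      using w(1) by blast
  qed
qed

lemma F3_compact_bound:
  assumes "F3 F" and "compact K"
  obtains M where "M > 0" "\<And>x v. x \<in> K \<Longrightarrow> v \<in> F x \<Longrightarrow> norm v \<le> M"
proof -
  obtain \<gamma> c where gc: "\<gamma> > 0" "c > 0" "\<And>x v. v \<in> F x \<Longrightarrow> norm v \<le> \<gamma> * norm x + c"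
    using assms(1) unfolding F3_def by blast
  obtain B where B: "B > 0" "\<And>x. x \<in> K \<Longrightarrow> norm x \<le> B"
    using compact_imp_bounded[OF assms(2)] by (auto simp: bounded_pos)
  show thesis
  proof
    show "\<gamma> * B + c > 0" using gc B by (simp add: add_pos_pos)
    fix x v assume "x \<in> K" "v \<in> F x"
    then have "norm v \<le> \<gamma> * norm x + c" "\<gamma> * norm x \<le> \<gamma> * B"
      using gc B by auto
    then show "norm v \<le> \<gamma> * B + c" by linarith
  qed
qed

text \<open>Adding the two variational inequalities for the projections gives Hoelder continuity of the
  projection with exponent 1/2 in the Hausdorff distance of the sets.\<close>

lemma closest_point_hausdorff:
  fixes w :: "'a::euclidean_space"
  assumes A: "convex A" "closed A" "A \<noteq> {}" and B: "convex B" "closed B" "B \<noteq> {}"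
    and AB: "\<And>u. u \<in> A \<Longrightarrow> \<exists>z\<in>B. dist u z \<le> \<epsilon>" and BA: "\<And>u. u \<in> B \<Longrightarrow> \<exists>z\<in>A. dist u z \<le> \<epsilon>"
  shows "(dist (closest_point A w) (closest_point B w))\<^sup>2
    \<le> \<epsilon> * (dist w (closest_point A w) + dist w (closest_point B w))"
proof -
  define p where "p = closest_point A w"
  define q where "q = closest_point B w"
  have pq: "p \<in> A" "q \<in> B"
    using A B by (auto simp: p_def q_def closest_point_in_set)
  \<comment> \<open>The variational inequality at \<open>p\<close> only tests points of
    \<open>A\<close>, so \<open>q\<close> is replaced by a nearby point \<open>a\<close> of
    \<open>A\<close>, and symmetrically \<open>p\<close> by \<open>b\<close>.\<close>
  obtain a where a: "a \<in> A" "dist q a \<le> \<epsilon>" using BA pq by blast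
  obtain b where b: "b \<in> B" "dist p b \<le> \<epsilon>" using AB pq by blast
  have "(w - p) \<bullet> (a - p) \<le> 0"
    using A a by (simp add: p_def closest_point_dot)
  moreover have "(w - q) \<bullet> (b - q) \<le> 0"
    using B b by (simp add: q_def closest_point_dot)
  moreover have "(w - p) \<bullet> (q - a) \<le> norm (w - p) * \<epsilon>"
    using norm_cauchy_schwarz[of "w - p" "q - a"] mult_left_mono[OF a(2), of "norm (w - p)"]
    by (simp add: dist_norm)
  moreover have "(w - q) \<bullet> (p - b) \<le> norm (w - q) * \<epsilon>"
    using norm_cauchy_schwarz[of "w - q" "p - b"] mult_left_mono[OF b(2), of "norm (w - q)"]
    by (simp add: dist_norm)
  \<comment> \<open>The right-hand side regroups to
    \<open>(w - p) \<bullet> (q - p) + (w - q) \<bullet> (p - q)\<close>, where \<open>w\<close>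
    cancels.\<close>
  moreover have "(norm (p - q))\<^sup>2
      = (w - p) \<bullet> (a - p) + (w - q) \<bullet> (b - q) + (w - p) \<bullet> (q - a) + (w - q) \<bullet> (p - b)"
    by (simp add: power2_norm_eq_inner algebra_simps inner_commute)
  ultimately show ?thesis
    unfolding p_def[symmetric] q_def[symmetric] by (simp add: dist_norm algebra_simps)
qed

text \<open>Moving the projected point costs at most its displacement, because projection is
  nonexpansive. Moving the set costs the square root of its Hausdorff displacement times
  \<open>4 * M\<close>, since the projected point and the values of \<open>F\<close> have norm at
  most \<open>M\<close>. Both costs tend to 0.\<close>

lemma continuous_on_closest_point_multifunction:
  fixes F :: "'a::euclidean_space \<Rightarrow> 'a set"
  assumes "F1 F"
    and L: "\<And>x y u. x \<in> K \<Longrightarrow> y \<in> K \<Longrightarrow> u \<in> F x \<Longrightarrow> \<exists>w\<in>F y. dist u w \<le> L * dist x y"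
    and M: "\<And>x v. x \<in> K \<Longrightarrow> v \<in> F x \<Longrightarrow> norm v \<le> M"
    and X: "continuous_on S X" "\<And>t. t \<in> S \<Longrightarrow> X t \<in> K"
    and V: "continuous_on S V" "\<And>t. t \<in> S \<Longrightarrow> norm (V t) \<le> M"
  shows "continuous_on S (\<lambda>t. closest_point (F (X t)) (V t))"
  unfolding continuous_on_def
proof
  fix t assume t: "t \<in> S"
  let ?P = "\<lambda>s. closest_point (F (X s))"
  have F: "F x \<noteq> {}" "closed (F x)" "convex (F x)" for x
    using \<open>F1 F\<close> by (auto simp: F1_def compact_imp_closed)
  have bound: "dist (?P s (V s)) (?P t (V t)) \<le> dist (V s) (V t) + sqrt (L * dist (X s) (X t) * (4 * M))"
    if s: "s \<in> S" for s
  proof -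
    have d: "dist (V t) (?P r (V t)) \<le> 2 * M" if "r \<in> S" for r
    proof -
      have "?P r (V t) \<in> F (X r)" using F by (simp add: closest_point_in_set)
      then have "norm (?P r (V t)) \<le> M" using M X(2) that by blast
      then show ?thesis using V(2)[OF t] norm_triangle_ineq4[of "V t" "?P r (V t)"]
        by (simp add: dist_norm)
    qed
    \<comment> \<open>The sign is read off from a distance that this product dominates.\<close>
    have "0 \<le> L * dist (X s) (X t)"
    proof -
      obtain u where "u \<in> F (X s)" using F by blast
      then obtain w where "dist u w \<le> L * dist (X s) (X t)" using L X(2) s t by meson
      then show ?thesis using zero_le_dist[of u w] by linarith
    qed
    have "(dist (?P s (V t)) (?P t (V t)))\<^sup>2
        \<le> L * dist (X s) (X t) * (dist (V t) (?P s (V t)) + dist (V t) (?P t (V t)))"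
      by (rule closest_point_hausdorff)
        (use F L[OF X(2)[OF s] X(2)[OF t]] L[OF X(2)[OF t] X(2)[OF s]] in \<open>auto simp: dist_commute\<close>)
    also have "\<dots> \<le> L * dist (X s) (X t) * (4 * M)"
      using d[OF s] d[OF t] \<open>0 \<le> L * dist (X s) (X t)\<close> by (intro mult_left_mono) auto
    finally have "dist (?P s (V t)) (?P t (V t)) \<le> sqrt (L * dist (X s) (X t) * (4 * M))"
      by (rule real_le_rsqrt)
    moreover have "dist (?P s (V s)) (?P s (V t)) \<le> dist (V s) (V t)"
      using F by (intro closest_point_lipschitz)
    ultimately show ?thesis
      using dist_triangle[of "?P s (V s)" "?P t (V t)" "?P s (V t)"] by linarith
  qed
  have "((\<lambda>s. dist (V s) (V t) + sqrt (L * dist (X s) (X t) * (4 * M))) \<longlongrightarrow>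
      dist (V t) (V t) + sqrt (L * dist (X t) (X t) * (4 * M))) (at t within S)"
    using X(1) V(1) t by (intro tendsto_intros) (auto simp: continuous_on_def)
  then have lim: "((\<lambda>s. dist (V s) (V t) + sqrt (L * dist (X s) (X t) * (4 * M))) \<longlongrightarrow> 0) (at t within S)"
    by simp
  have "((\<lambda>s. dist (?P s (V s)) (?P t (V t))) \<longlongrightarrow> 0) (at t within S)"
    by (rule tendsto_sandwich[OF _ _ tendsto_const lim])
      (auto simp: eventually_at_filter bound)
  then show "((\<lambda>s. ?P s (V s)) \<longlongrightarrow> ?P t (V t)) (at t within S)"
    by (rule iffD2[OF tendsto_dist_iff])
qed

section \<open>Trajectories with prescribed initial velocity\<close>

lemma abs_continuous_on_Lipschitz:
  assumes "\<And>s t. s \<in> I \<Longrightarrow> t \<in> I \<Longrightarrow> s \<le> t \<Longrightarrow> norm (x t - x s) \<le> M * (t - s)" and "M > 0"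
  shows "abs_continuous_on I x"
  unfolding abs_continuous_on_def
proof (intro allI impI, rule exI, intro conjI allI impI)
  fix \<epsilon> :: real assume "\<epsilon> > 0"
  then show "\<epsilon> / M > 0" using \<open>M > 0\<close> by simp
  fix D assume D: "finite D \<and> (\<forall>(a, b)\<in>D. a \<le> b \<and> {a..b} \<subseteq> I) \<and>
    disjoint_family_on (\<lambda>(a, b). {a<..<b}) D \<and> (\<Sum>(a, b)\<in>D. b - a) < \<epsilon> / M"
  have "(\<Sum>(a, b)\<in>D. norm (x b - x a)) \<le> (\<Sum>(a, b)\<in>D. M * (b - a))"
  proof (rule sum_mono, clarify)
    fix a b assume "(a, b) \<in> D"
    with D have "a \<le> b" "{a..b} \<subseteq> I" by auto
    then show "norm (x b - x a) \<le> M * (b - a)" by (intro assms) auto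
  qed
  also have "\<dots> = M * (\<Sum>(a, b)\<in>D. b - a)"
    by (simp add: sum_distrib_left case_prod_unfold)
  also have "\<dots> < \<epsilon>"
    using D \<open>M > 0\<close> by (simp add: field_simps)
  finally show "(\<Sum>(a, b)\<in>D. norm (x b - x a)) < \<epsilon>" .
qed

text \<open>Filippov's successive approximations: every velocity is the projection of the preceding one
  onto the values of \<open>F\<close> along the preceding arc. Since the projection depends continuously on
  the set, the velocities stay continuous, and they all start at \<open>v\<close>.\<close>

primrec filippov_velocity :: "('a::euclidean_space \<Rightarrow> 'a set) \<Rightarrow> 'a \<Rightarrow> 'a \<Rightarrow> nat \<Rightarrow> real \<Rightarrow> 'a" where
  "filippov_velocity F \<alpha> v 0 = (\<lambda>t. v)"
| "filippov_velocity F \<alpha> v (Suc n) =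
     (\<lambda>t. closest_point (F (\<alpha> + integral {0..t} (filippov_velocity F \<alpha> v n))) (filippov_velocity F \<alpha> v n t))"

text \<open>The Weierstrass M-test applies to the telescoping series of the differences.\<close>

lemma uniformly_convergent_on_geometric:
  fixes f :: "nat \<Rightarrow> 'b \<Rightarrow> 'a::banach"
  assumes "\<And>n x. x \<in> S \<Longrightarrow> norm (f (Suc n) x - f n x) \<le> C * (1/2) ^ n"
  shows "uniformly_convergent_on S f"
proof -
  have "uniformly_convergent_on S (\<lambda>n x. \<Sum>i<n. f (Suc i) x - f i x)"
    by (rule Weierstrass_m_test'[where M = "\<lambda>n. C * (1/2) ^ n"])
      (auto intro!: summable_mult summable_geometric assms)
  then obtain l where "uniform_limit S (\<lambda>n x. \<Sum>i<n. f (Suc i) x - f i x) l sequentially"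
    unfolding uniformly_convergent_on_def by blast
  then have "uniform_limit S (\<lambda>n x. f n x - f 0 x) l sequentially"
    by (simp add: sum_lessThan_telescope[of "\<lambda>n. f n x" for x])
  then have "uniform_limit S (\<lambda>n x. (f n x - f 0 x) + f 0 x) (\<lambda>x. l x + f 0 x) sequentially"
    by (intro uniform_limit_add uniform_limit_const)
  then show ?thesis
    unfolding uniformly_convergent_on_def by auto
qed

text \<open>The velocities converge uniformly, so their limit \<open>W\<close> is continuous with
  \<open>W 0 = v\<close>, and the limit arc has derivative \<open>W t\<close> at every time. This
  pins down the derivative at 0, a single point that an a.e. statement cannot see.\<close>

lemma trajectory_with_initial_velocity:
  fixes F :: "'a::euclidean_space \<Rightarrow> 'a set"
  assumes "F1 F" "F2 F" "F3 F" and v: "v \<in> F \<alpha>"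
  obtains \<tau> x where "\<tau> > 0" "trajectory_on F {0..\<tau>} x" "x 0 = \<alpha>"
    "(x has_vector_derivative v) (at 0 within {0..\<tau>})"
proof -
  let ?K = "cball \<alpha> 1"
  obtain L where "L > 0" and L: "\<And>x y u. x \<in> ?K \<Longrightarrow> y \<in> ?K \<Longrightarrow> u \<in> F x \<Longrightarrow> \<exists>w\<in>F y. dist u w \<le> L * dist x y"
    using F2_compact[OF \<open>F2 F\<close> compact_cball] by metis
  obtain M where "M > 0" and M: "\<And>x v. x \<in> ?K \<Longrightarrow> v \<in> F x \<Longrightarrow> norm v \<le> M"
    using F3_compact_bound[OF \<open>F3 F\<close> compact_cball] by metis
  have F: "F x \<noteq> {}" "closed (F x)" "convex (F x)" for x
    using \<open>F1 F\<close> by (auto simp: F1_def compact_imp_closed)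
  \<comment> \<open>The bound \<open>1 / M\<close> keeps all arcs in the unit ball around
    \<open>\<alpha>\<close>; the bound \<open>1 / (2 * L)\<close> makes the iteration contract by
    the factor 1/2.\<close>
  define \<tau> where "\<tau> = min (1 / M) (1 / (2 * L))"
  have \<tau>: "\<tau> > 0" "M * \<tau> \<le> 1" "L * \<tau> \<le> 1 / 2"
    using \<open>L > 0\<close> \<open>M > 0\<close> by (auto simp: \<tau>_def min_def field_simps)
  define V where "V = filippov_velocity F \<alpha> v"
  define X where "X = (\<lambda>n t. \<alpha> + integral {0..t} (V n))"
  have V_0: "V 0 = (\<lambda>t. v)" and V_Suc: "V (Suc n) = (\<lambda>t. closest_point (F (X n t)) (V n t))" for n
    by (auto simp: V_def X_def)
  have primitive_in_ball: "\<alpha> + integral {0..t} w \<in> ?K"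
    if "continuous_on {0..\<tau>} w" "\<And>t. t \<in> {0..\<tau>} \<Longrightarrow> norm (w t) \<le> M" "t \<in> {0..\<tau>}" for w t
  proof -
    have "norm (integral {0..t} w) \<le> M * (t - 0)"
      using that by (intro integral_bound) (auto intro: continuous_on_subset)
    also have "\<dots> \<le> M * \<tau>" using that \<open>M > 0\<close> by auto
    finally show ?thesis using \<tau> by (simp add: dist_norm)
  qed
  have continuous_primitive: "continuous_on {0..\<tau>} (\<lambda>t. \<alpha> + integral {0..t} w)"
    if "continuous_on {0..\<tau>} w" for w :: "real \<Rightarrow> 'a"
    using that by (intro continuous_intros indefinite_integral_continuous_1 integrable_continuous_real)
  have V: "continuous_on {0..\<tau>} (V n) \<and> (\<forall>t\<in>{0..\<tau>}. norm (V n t) \<le> M) \<and> V n 0 = v" for n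
  proof (induction n)
    case 0
    then show ?case using M[OF _ v] by (simp add: V_0)
  next
    case (Suc n)
    then have X: "X n t \<in> ?K" if "t \<in> {0..\<tau>}" for t
      unfolding X_def using that by (intro primitive_in_ball) auto
    have "continuous_on {0..\<tau>} (V (Suc n))"
      unfolding V_Suc
    proof (rule continuous_on_closest_point_multifunction[where K = ?K and L = L and M = M, OF \<open>F1 F\<close> L M])
      show "continuous_on {0..\<tau>} (X n)" unfolding X_def using Suc by (intro continuous_primitive) auto
    qed (use Suc X in auto)
    moreover have "norm (V (Suc n) t) \<le> M" if "t \<in> {0..\<tau>}" for t
      using M[OF X[OF that]] closest_point_in_set[OF F(2,1)] by (simp add: V_Suc)
    \<comment> \<open>At time 0 the preceding arc is at \<open>\<alpha>\<close>, and
      \<open>v\<close> already lies in \<open>F \<alpha>\<close>, so the projection fixes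
      it.\<close>
    moreover have "V (Suc n) 0 = v"
      using Suc v by (simp add: V_Suc X_def closest_point_self)
    ultimately show ?case by blast
  qed
  have X: "X n t \<in> ?K" if "t \<in> {0..\<tau>}" for n t
    unfolding X_def using that V by (intro primitive_in_ball) auto
  have primitive_dist: "norm ((\<alpha> + integral {0..t} w) - (\<alpha> + integral {0..t} w')) \<le> e * \<tau>"
    if "continuous_on {0..\<tau>} w" "continuous_on {0..\<tau>} w'" "\<And>t. t \<in> {0..\<tau>} \<Longrightarrow> norm (w t - w' t) \<le> e"
      "t \<in> {0..\<tau>}" for w w' :: "real \<Rightarrow> 'a" and e t
  proof -
    have c: "continuous_on {0..t} w" "continuous_on {0..t} w'"
      using that by (auto intro: continuous_on_subset)
    then have "(\<alpha> + integral {0..t} w) - (\<alpha> + integral {0..t} w') = integral {0..t} (\<lambda>s. w s - w' s)"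
      by (simp add: integral_diff integrable_continuous_real)
    also have "norm \<dots> \<le> e * (t - 0)"
      using that c by (intro integral_bound continuous_intros) auto
    also have "\<dots> \<le> e * \<tau>"
    proof -
      have "0 \<le> e" using norm_ge_zero[of "w t - w' t"] that(3)[OF that(4)] by linarith
      then show ?thesis using that(4) by (intro mult_left_mono) auto
    qed
    finally show ?thesis .
  qed
  \<comment> \<open>The projection is nearest, so a velocity changes by at most \<open>L\<close>
    times the distance of the two preceding arcs, which is at most \<open>\<tau>\<close> times the
    previous change of velocity. For \<open>n = 0\<close> that distance is at most 1.\<close>
  have step: "norm (V (Suc n) t - V n t) \<le> L * (1/2) ^ n" if "t \<in> {0..\<tau>}" for n t
    using that
  proof (induction n arbitrary: t)
    case 0
    obtain w where w: "w \<in> F (X 0 t)" "dist v w \<le> L * dist \<alpha> (X 0 t)"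
      using L[OF _ X[OF 0] v] by auto
    have "dist (V 0 t) (V (Suc 0) t) \<le> dist v w"
      using w(1) F by (simp add: V_0 V_Suc closest_point_le)
    also have "\<dots> \<le> L * 1"
      using X[OF 0, of 0] \<open>L > 0\<close> by (intro order_trans[OF w(2)] mult_left_mono) auto
    finally show ?case by (simp add: dist_norm norm_minus_commute)
  next
    case (Suc n)
    have "V (Suc n) t \<in> F (X n t)" using F by (simp add: V_Suc closest_point_in_set)
    then obtain w where w: "w \<in> F (X (Suc n) t)" "dist (V (Suc n) t) w \<le> L * dist (X n t) (X (Suc n) t)"
      using L X[OF Suc.prems] by meson
    have "dist (V (Suc n) t) (V (Suc (Suc n)) t) \<le> dist (V (Suc n) t) w"
      using closest_point_le[OF F(2) w(1)] by (simp only: V_Suc[of "Suc n"])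
    also have "\<dots> \<le> L * (L * (1/2) ^ n * \<tau>)"
    proof (rule order_trans[OF w(2)], rule mult_left_mono)
      show "dist (X n t) (X (Suc n) t) \<le> L * (1/2) ^ n * \<tau>"
        unfolding dist_norm norm_minus_commute[of "X n t"] unfolding X_def
        using V Suc by (intro primitive_dist) auto
    qed (use \<open>L > 0\<close> in simp)
    also have "\<dots> = L * (1/2) ^ n * (L * \<tau>)" by simp
    also have "\<dots> \<le> L * (1/2) ^ n * (1/2)"
      using \<tau>(3) \<open>L > 0\<close> by (intro mult_left_mono) auto
    finally show ?case by (simp add: dist_norm norm_minus_commute)
  qed
  then have "uniformly_convergent_on {0..\<tau>} V"
    by (rule uniformly_convergent_on_geometric)
  then obtain W where W: "uniform_limit {0..\<tau>} V W sequentially"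
    unfolding uniformly_convergent_on_def by blast
  have W_cont: "continuous_on {0..\<tau>} W"
    by (rule uniform_limit_theorem[OF _ W]) (use V in auto)
  have W_lim: "(\<lambda>n. V n t) \<longlonglongrightarrow> W t" if "t \<in> {0..\<tau>}" for t
    using tendsto_uniform_limitI[OF W that] .
  have W_bound: "norm (W t) \<le> M" if "t \<in> {0..\<tau>}" for t
    by (rule Lim_norm_ubound[OF _ W_lim[OF that]]) (use V that in auto)
  have W_0: "W 0 = v"
    using LIMSEQ_unique[OF W_lim[of 0]] V \<tau> by simp
  define x where "x = (\<lambda>t. \<alpha> + integral {0..t} W)"
  have x_deriv: "(x has_vector_derivative W t) (at t within {0..\<tau>})" if "t \<in> {0..\<tau>}" for t
    unfolding x_def using integral_has_vector_derivative[OF W_cont that]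
    by (auto intro!: derivative_eq_intros)
  have x_K: "x t \<in> ?K" if "t \<in> {0..\<tau>}" for t
    unfolding x_def using that W_cont W_bound by (intro primitive_in_ball) auto
  have X_lim: "(\<lambda>n. X n t) \<longlonglongrightarrow> x t" if t: "t \<in> {0..\<tau>}" for t
  proof (rule LIMSEQ_I)
    fix e :: real assume "e > 0"
    then have "e / (2 * \<tau>) > 0" using \<tau> by simp
    then obtain n0 where n0: "\<And>n s. n \<ge> n0 \<Longrightarrow> s \<in> {0..\<tau>} \<Longrightarrow> dist (V n s) (W s) < e / (2 * \<tau>)"
      using W unfolding uniform_limit_sequentially_iff by meson
    have "norm (X n t - x t) < e" if "n \<ge> n0" for n
    proof -
      have "norm (X n t - x t) \<le> e / (2 * \<tau>) * \<tau>"
        unfolding X_def x_def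
        by (rule primitive_dist) (use V W_cont t n0[OF that] in \<open>auto simp: dist_norm less_imp_le\<close>)
      with \<tau> \<open>e > 0\<close> show ?thesis by simp
    qed
    then show "\<exists>n0. \<forall>n\<ge>n0. norm (X n t - x t) < e" by blast
  qed
  \<comment> \<open>The velocity \<open>V (Suc n) t\<close> lies in \<open>F (X n t)\<close>, hence
    close to some \<open>w n\<close> in \<open>F (x t)\<close>. These points tend to
    \<open>W t\<close> as well, and \<open>F (x t)\<close> is closed.\<close>
  have W_mem: "W t \<in> F (x t)" if t: "t \<in> {0..\<tau>}" for t
  proof -
    have "\<forall>n. \<exists>w\<in>F (x t). dist (V (Suc n) t) w \<le> L * dist (X n t) (x t)"
      using L[OF X[OF t] x_K[OF t]] F by (simp add: V_Suc closest_point_in_set)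
    then obtain w where w: "\<And>n. w n \<in> F (x t)" "\<And>n. dist (V (Suc n) t) (w n) \<le> L * dist (X n t) (x t)"
      by metis
    have "(\<lambda>n. L * dist (X n t) (x t)) \<longlonglongrightarrow> L * dist (x t) (x t)"
      by (intro tendsto_intros X_lim t)
    then have lim: "(\<lambda>n. L * dist (X n t) (x t)) \<longlonglongrightarrow> 0" by simp
    have "(\<lambda>n. dist (V (Suc n) t) (w n)) \<longlonglongrightarrow> 0"
      by (rule tendsto_sandwich[OF _ _ tendsto_const lim]) (auto simp: w)
    then have "(\<lambda>n. V (Suc n) t - w n) \<longlonglongrightarrow> 0"
      by (simp add: dist_norm tendsto_norm_zero_iff)
    from tendsto_diff[OF LIMSEQ_Suc[OF W_lim[OF t]] this] have "w \<longlonglongrightarrow> W t" by simp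
    then show ?thesis
      using closed_sequentially[OF F(2)] w(1) by blast
  qed
  show thesis
  proof
    show "\<tau> > 0" by fact
    show "x 0 = \<alpha>" by (simp add: x_def)
    show "(x has_vector_derivative v) (at 0 within {0..\<tau>})"
      using x_deriv[of 0] W_0 \<tau> by simp
    have "norm (x t - x s) \<le> M * (t - s)" if "s \<in> {0..\<tau>}" "t \<in> {0..\<tau>}" "s \<le> t" for s t
    proof -
      have c: "continuous_on {0..t} W" "continuous_on {s..t} W"
        using that W_cont by (auto intro: continuous_on_subset)
      have "integral {0..s} W + integral {s..t} W = integral {0..t} W"
        using that c by (intro Henstock_Kurzweil_Integration.integral_combine integrable_continuous_real) auto
      then have "x t - x s = integral {s..t} W" by (simp add: x_def algebra_simps)
      also have "norm \<dots> \<le> M * (t - s)"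
        using that W_bound c by (intro integral_bound) auto
      finally show ?thesis .
    qed
    then have "abs_continuous_on {0..\<tau>} x"
      using \<open>M > 0\<close> by (rule abs_continuous_on_Lipschitz)
    moreover have "AE t in lebesgue_on {0..\<tau>}. \<exists>v\<in>F (x t). (x has_vector_derivative v) (at t within {0..\<tau>})"
      using x_deriv W_mem by (intro AE_I2) auto
    ultimately show "trajectory_on F {0..\<tau>} x"
      unfolding trajectory_on_def by blast
  qed
qed

section \<open>Subgradients at a zero of a nonnegative function\<close>

lemma frechet_subdifferential_zero_iff:
  assumes "f x = 0" and "\<And>y. 0 \<le> f y"
  shows "\<zeta> \<in> frechet_subdifferential f x \<longleftrightarrow>
    (\<forall>\<epsilon>>0. \<forall>\<^sub>F y in at x. ereal (\<zeta> \<bullet> (y - x) - \<epsilon> * norm (y - x)) \<le> f y)"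
proof -
  let ?Q = "\<lambda>y. (f y - f x - ereal (\<zeta> \<bullet> (y - x))) / ereal (norm (y - x))"
  \<comment> \<open>For finite \<open>f y\<close> this is multiplication by a positive norm; for
    \<open>f y = \<infinity>\<close> both sides hold.\<close>
  have le_quotient: "ereal (- \<epsilon>) \<le> ?Q y \<longleftrightarrow> ereal (\<zeta> \<bullet> (y - x) - \<epsilon> * norm (y - x)) \<le> f y"
    if "y \<noteq> x" for y \<epsilon>
  proof (cases "f y")
    case (real r)
    then have "?Q y = ereal ((r - \<zeta> \<bullet> (y - x)) / norm (y - x))"
      using \<open>f x = 0\<close> that by simp
    then show ?thesis
      using real that by (simp add: le_divide_eq algebra_simps)
  next
    case PInf
    then show ?thesis using \<open>f x = 0\<close> that by simp
  next
    case MInf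
    then show ?thesis using assms(2)[of y] by simp
  qed
  have "0 \<le> Liminf (at x) ?Q \<longleftrightarrow> (\<forall>\<epsilon>>0. \<forall>\<^sub>F y in at x. ereal (- \<epsilon>) \<le> ?Q y)"
    unfolding le_Liminf_iff
  proof (intro iffI allI impI)
    fix \<epsilon> :: real assume *: "\<forall>c<0. \<forall>\<^sub>F y in at x. c < ?Q y" and "\<epsilon> > 0"
    then have "\<forall>\<^sub>F y in at x. ereal (- \<epsilon>) < ?Q y" by simp
    then show "\<forall>\<^sub>F y in at x. ereal (- \<epsilon>) \<le> ?Q y" by (rule eventually_mono) simp
  next
    fix c :: ereal assume *: "\<forall>\<epsilon>>0. \<forall>\<^sub>F y in at x. ereal (- \<epsilon>) \<le> ?Q y" and "c < 0"
    \<comment> \<open>As \<open>c\<close> may be \<open>-\<infinity>\<close>, a real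
      \<open>z\<close> strictly between \<open>c\<close> and 0 supplies \<open>- z\<close> as the
      tolerance and turns the weak bound into a strict one.\<close>
    then obtain z where z: "c < ereal z" "z < 0"
      using ereal_dense2[of c 0] by auto
    then have "\<forall>\<^sub>F y in at x. ereal (- (- z)) \<le> ?Q y" using *[rule_format, of "- z"] by simp
    then show "\<forall>\<^sub>F y in at x. c < ?Q y" by (rule eventually_mono) (use z in auto)
  qed
  also have "\<dots> \<longleftrightarrow> (\<forall>\<epsilon>>0. \<forall>\<^sub>F y in at x. ereal (\<zeta> \<bullet> (y - x) - \<epsilon> * norm (y - x)) \<le> f y)"
    unfolding eventually_at_filter using le_quotient
    by (intro all_cong imp_cong refl arg_cong2[where f = eventually]) (auto simp: fun_eq_iff)
  finally show ?thesis
    unfolding frechet_subdifferential_def using \<open>f x = 0\<close> by simp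
qed

section \<open>Restriction of trajectories and confinement to a ball\<close>

lemma trajectory_on_subset:
  assumes x: "trajectory_on F I x" and "J \<subseteq> I" "I \<in> sets lebesgue" "J \<in> sets lebesgue"
  shows "trajectory_on F J x"
  unfolding trajectory_on_def
proof
  show "abs_continuous_on J x"
    using x \<open>J \<subseteq> I\<close> by (auto simp: trajectory_on_def intro: abs_continuous_on_subset)
  have "AE t in lebesgue. t \<in> I \<longrightarrow> (\<exists>v\<in>F (x t). (x has_vector_derivative v) (at t within I))"
    using x \<open>I \<in> sets lebesgue\<close> by (simp add: trajectory_on_def AE_restrict_space_iff)
  then have "AE t in lebesgue. t \<in> J \<longrightarrow> (\<exists>v\<in>F (x t). (x has_vector_derivative v) (at t within J))"
    by (rule eventually_mono) (use \<open>J \<subseteq> I\<close> in \<open>blast intro: has_vector_derivative_within_subset\<close>)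
  then show "AE t in lebesgue_on J. \<exists>v\<in>F (x t). (x has_vector_derivative v) (at t within J)"
    using \<open>J \<in> sets lebesgue\<close> by (simp add: AE_restrict_space_iff)
qed

lemma abs_continuous_on_imp_continuous_on:
  assumes "abs_continuous_on {a..b} f"
  shows "continuous_on {a..b} f"
  unfolding continuous_on_iff
proof (intro ballI allI impI)
  fix t \<epsilon> :: real assume t: "t \<in> {a..b}" and "\<epsilon> > 0"
  obtain \<delta> where "\<delta> > 0" and \<delta>: "\<forall>D. finite D \<and> (\<forall>(u, v)\<in>D. u \<le> v \<and> {u..v} \<subseteq> {a..b}) \<and>
        disjoint_family_on (\<lambda>(u, v). {u<..<v}) D \<and> (\<Sum>(u, v)\<in>D. v - u) < \<delta> \<longrightarrow>
        (\<Sum>(u, v)\<in>D. norm (f v - f u)) < \<epsilon>"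
    using assms[unfolded abs_continuous_on_def, rule_format, OF \<open>\<epsilon> > 0\<close>] by (elim exE conjE)
  have less: "norm (f v - f u) < \<epsilon>" if "u \<in> {a..b}" "v \<in> {a..b}" "u \<le> v" "v - u < \<delta>" for u v
    using \<delta>[rule_format, of "{(u, v)}"] that by (auto simp: disjoint_family_on_def)
  have "dist (f s) (f t) < \<epsilon>" if "s \<in> {a..b}" "dist s t < \<delta>" for s
    using less[of s t] less[of t s] t that
    by (cases "s \<le> t") (auto simp: dist_norm norm_minus_commute)
  then show "\<exists>d>0. \<forall>s\<in>{a..b}. dist s t < d \<longrightarrow> dist (f s) (f t) < \<epsilon>"
    using \<open>\<delta> > 0\<close> by blast
qed

text \<open>First exit argument: the speed bound \<open>M\<close> is known only inside the ball, but
  it holds up to the first exit time, and by then the arc has moved too little to have left.\<close>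

lemma trajectory_stays_in_ball:
  assumes x: "trajectory_on F {0..\<tau>} x"
    and M: "\<And>y v. y \<in> ball \<alpha> \<delta> \<Longrightarrow> v \<in> F y \<Longrightarrow> norm v \<le> M"
    and "M \<ge> 0" and small: "dist \<alpha> (x 0) + M * \<tau> < \<delta>" and t: "t \<in> {0..\<tau>}"
  shows "x t \<in> ball \<alpha> \<delta>"
proof (rule ccontr)
  assume "x t \<notin> ball \<alpha> \<delta>"
  have cont: "continuous_on {0..\<tau>} x"
    using x by (auto simp: trajectory_on_def intro: abs_continuous_on_imp_continuous_on)
  define E where "E = {0..\<tau>} \<inter> x -` (- ball \<alpha> \<delta>)"
  have "compact E"
    unfolding E_def compact_eq_bounded_closed
    using continuous_closed_preimage[OF cont, of "- ball \<alpha> \<delta>"]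
    by (auto simp: closed_Compl intro: bounded_subset[OF bounded_closed_interval])
  moreover have "E \<noteq> {}" using t \<open>x t \<notin> ball \<alpha> \<delta>\<close> by (auto simp: E_def)
  ultimately obtain s where s: "s \<in> E" "\<And>r. r \<in> E \<Longrightarrow> s \<le> r"
    using continuous_attains_inf[of E "\<lambda>s. s"] continuous_on_id by auto
  have s\<tau>: "0 \<le> s" "s \<le> \<tau>" "\<delta> \<le> dist \<alpha> (x s)"
    using s(1) by (auto simp: E_def)
  have before: "x r \<in> ball \<alpha> \<delta>" if "0 \<le> r" "r < s" for r
    using s(2)[of r] that s\<tau> by (auto simp: E_def)
  have "trajectory_on F {0..s} x"
    by (rule trajectory_on_subset[OF x]) (use s\<tau> in auto)
  then have ac: "abs_continuous_on {0..s} x"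
    and ae: "AE r in lebesgue. r \<in> {0..s} \<longrightarrow> (\<exists>v\<in>F (x r). (x has_vector_derivative v) (at r within {0..s}))"
    by (auto simp: trajectory_on_def AE_restrict_space_iff)
  \<comment> \<open>Testing the displacement \<open>u\<close> against its own direction turns the
    scalar increment estimate into the norm bound \<open>norm u \<le> M * s\<close>.\<close>
  define u where "u = x s - x 0"
  have "- (M * norm u) * (s - 0) \<le> (x s - x 0) \<bullet> (- u)"
  proof (rule abs_continuous_inner_increment_ge[OF s\<tau>(1) ac])
    \<comment> \<open>At the exit time itself \<open>x s\<close> is outside the ball, where
      \<open>M\<close> gives no bound; a single time is negligible.\<close>
    have "AE r in lebesgue. r \<noteq> s"
      by (intro AE_completion AE_lborel_singleton)
    with ae have "AE r in lebesgue. r \<in> {0..s} \<longrightarrow>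
        (\<exists>v. (x has_vector_derivative v) (at r within {0..s}) \<and> - (M * norm u) \<le> v \<bullet> (- u))"
    proof eventually_elim
      fix r assume r: "r \<in> {0..s} \<longrightarrow> (\<exists>v\<in>F (x r). (x has_vector_derivative v) (at r within {0..s}))" "r \<noteq> s"
      show "r \<in> {0..s} \<longrightarrow> (\<exists>v. (x has_vector_derivative v) (at r within {0..s}) \<and> - (M * norm u) \<le> v \<bullet> (- u))"
      proof
        assume "r \<in> {0..s}"
        with r obtain v where v: "v \<in> F (x r)" "(x has_vector_derivative v) (at r within {0..s})" by blast
        have "norm v \<le> M"
          using M[OF before v(1)] r \<open>r \<in> {0..s}\<close> by auto
        then have "v \<bullet> u \<le> M * norm u"
          using norm_cauchy_schwarz[of v u] mult_right_mono[of "norm v" M "norm u"] by simp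
        then show "\<exists>v. (x has_vector_derivative v) (at r within {0..s}) \<and> - (M * norm u) \<le> v \<bullet> (- u)"
          using v(2) by auto
      qed
    qed
    then show "AE r in lebesgue_on {0..s}.
        \<exists>v. (x has_vector_derivative v) (at r within {0..s}) \<and> - (M * norm u) \<le> v \<bullet> (- u)"
      by (simp add: AE_restrict_space_iff)
  qed
  then have "norm u * norm u \<le> (M * s) * norm u"
    unfolding u_def[symmetric] by (simp add: dot_square_norm power2_eq_square algebra_simps)
  then have "norm u \<le> M * s"
    using \<open>M \<ge> 0\<close> s\<tau> by (cases "u = 0") auto
  also have "\<dots> \<le> M * \<tau>" using s\<tau> \<open>M \<ge> 0\<close> by (intro mult_left_mono)
  finally have "dist \<alpha> (x s) < \<delta>"
    using small dist_triangle[of \<alpha> "x s" "x 0"] by (simp add: u_def dist_norm norm_minus_commute)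
  with s\<tau> show False by simp
qed

section \<open>The two inclusions for the subdifferential on the diagonal\<close>

lemma min_time_le:
  assumes "trajectory_on F {0..\<tau>} x" "0 \<le> \<tau>"
  shows "min_time F (x 0, x \<tau>) \<le> ereal \<tau>"
  unfolding min_time_def prod.case using assms by (intro Inf_lower) auto

lemma frechet_subdifferential_min_time_diagD:
  fixes F :: "'a::euclidean_space \<Rightarrow> 'a set"
  assumes F: "F1 F" "F2 F" "F3 F"
    and sub: "(\<zeta>, \<eta>) \<in> frechet_subdifferential (min_time F) (\<alpha>, \<alpha>)"
  shows "\<eta> = - \<zeta>" and "\<And>v. v \<in> F \<alpha> \<Longrightarrow> - 1 \<le> v \<bullet> \<zeta>"
proof -
  \<comment> \<open>The base point, excluded from the punctured neighbourhood, is included here: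
    both sides are 0 there.\<close>
  have ev: "\<exists>d>0. \<forall>y z. dist (y, z) (\<alpha>, \<alpha>) < d \<longrightarrow>
      ereal (\<zeta> \<bullet> (y - \<alpha>) + \<eta> \<bullet> (z - \<alpha>) - \<epsilon> * norm (y - \<alpha>, z - \<alpha>)) \<le> min_time F (y, z)" if "\<epsilon> > 0" for \<epsilon>
  proof -
    have "\<forall>\<^sub>F y in at (\<alpha>, \<alpha>). ereal ((\<zeta>, \<eta>) \<bullet> (y - (\<alpha>, \<alpha>)) - \<epsilon> * norm (y - (\<alpha>, \<alpha>))) \<le> min_time F y"
      using sub that by (subst (asm) frechet_subdifferential_zero_iff) (auto simp: min_time_diag min_time_nonneg)
    then obtain d where "d > 0" and d: "\<And>y. y \<noteq> (\<alpha>, \<alpha>) \<Longrightarrow> dist y (\<alpha>, \<alpha>) < d \<Longrightarrow>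
        ereal ((\<zeta>, \<eta>) \<bullet> (y - (\<alpha>, \<alpha>)) - \<epsilon> * norm (y - (\<alpha>, \<alpha>))) \<le> min_time F y"
      unfolding eventually_at by auto
    show ?thesis
    proof (intro exI conjI allI impI)
      fix y z assume "dist (y, z) (\<alpha>, \<alpha>) < d"
      then show "ereal (\<zeta> \<bullet> (y - \<alpha>) + \<eta> \<bullet> (z - \<alpha>) - \<epsilon> * norm (y - \<alpha>, z - \<alpha>)) \<le> min_time F (y, z)"
        using d[of "(y, z)"] by (cases "(y, z) = (\<alpha>, \<alpha>)") (auto simp: min_time_diag norm_Pair)
    qed fact
  qed
  show eq: "\<eta> = - \<zeta>"
  proof (rule ccontr)
    assume "\<eta> \<noteq> - \<zeta>"
    \<comment> \<open>Shifting both arguments by \<open>s *\<^sub>R h\<close> keeps the minimal time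
      0 while the linear term is \<open>s * (norm h)\<^sup>2\<close>. With tolerance
      \<open>norm h / 4\<close> the error is at most half of that, because the shift of the pair has
      norm at most \<open>2 * (s * norm h)\<close>.\<close>
    define h where "h = \<zeta> + \<eta>"
    have "h \<noteq> 0" using \<open>\<eta> \<noteq> - \<zeta>\<close> by (auto simp: h_def eq_neg_iff_add_eq_0 add.commute)
    then obtain d where "d > 0" and d: "\<And>y z. dist (y, z) (\<alpha>, \<alpha>) < d \<Longrightarrow>
      ereal (\<zeta> \<bullet> (y - \<alpha>) + \<eta> \<bullet> (z - \<alpha>) - norm h / 4 * norm (y - \<alpha>, z - \<alpha>)) \<le> min_time F (y, z)"
      using ev[of "norm h / 4"] by auto
    define s where "s = d / (4 * norm h)"
    have s: "s > 0" "4 * (s * norm h) = d" using \<open>d > 0\<close> \<open>h \<noteq> 0\<close> by (auto simp: s_def)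
    have norm_le: "norm (s *\<^sub>R h, s *\<^sub>R h) \<le> 2 * (s * norm h)"
      using norm_Pair_le[of "s *\<^sub>R h" "s *\<^sub>R h"] s by simp
    also have "\<dots> < d" using s \<open>d > 0\<close> by linarith
    finally have "ereal (\<zeta> \<bullet> (s *\<^sub>R h) + \<eta> \<bullet> (s *\<^sub>R h) - norm h / 4 * norm (s *\<^sub>R h, s *\<^sub>R h)) \<le> 0"
      using d[of "\<alpha> + s *\<^sub>R h" "\<alpha> + s *\<^sub>R h"] by (simp add: dist_norm min_time_diag)
    then have "s * (h \<bullet> h) \<le> norm h / 4 * norm (s *\<^sub>R h, s *\<^sub>R h)"
      by (simp add: h_def inner_add_left algebra_simps zero_ereal_def)
    also have "\<dots> \<le> norm h / 4 * (2 * (s * norm h))"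
      using norm_le by (intro mult_left_mono) auto
    finally have "s * (norm h)\<^sup>2 \<le> s * (norm h)\<^sup>2 / 2"
      by (simp add: dot_square_norm power2_eq_square algebra_simps)
    moreover have "s * (norm h)\<^sup>2 > 0" using s \<open>h \<noteq> 0\<close> by simp
    ultimately show False by linarith
  qed
  fix v assume "v \<in> F \<alpha>"
  then obtain \<tau> x where "\<tau> > 0" and x: "trajectory_on F {0..\<tau>} x" "x 0 = \<alpha>"
    and x': "(x has_vector_derivative v) (at 0 within {0..\<tau>})"
    using trajectory_with_initial_velocity[OF F] by metis
  \<comment> \<open>This is the subgradient inequality at \<open>(\<alpha>, x s)\<close> divided by
    \<open>s\<close>: \<open>e * norm \<zeta>\<close> comes from the first-order expansion of
    \<open>x\<close> at 0, and \<open>e * (norm v + e)\<close> from the tolerance in the subgradient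
    inequality.\<close>
  have "- (v \<bullet> \<zeta>) \<le> 1 + e * (norm \<zeta> + (norm v + e))" if "e > 0" for e
  proof -
    obtain d where "d > 0" and d: "\<And>y z. dist (y, z) (\<alpha>, \<alpha>) < d \<Longrightarrow>
      ereal (\<zeta> \<bullet> (y - \<alpha>) + \<eta> \<bullet> (z - \<alpha>) - e * norm (y - \<alpha>, z - \<alpha>)) \<le> min_time F (y, z)"
      using ev[OF \<open>e > 0\<close>] by auto
    obtain d' where "d' > 0" and d': "\<And>s. s \<in> {0..\<tau>} \<Longrightarrow> norm (s - 0) < d' \<Longrightarrow>
        norm (x s - x 0 - (s - 0) *\<^sub>R v) \<le> e * norm (s - 0)"
      using x' \<open>e > 0\<close> unfolding has_vector_derivative_def has_derivative_within_alt by blast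
    \<comment> \<open>The three bounds keep \<open>s\<close> in the domain of the trajectory, in the
      range of the first-order expansion, and small enough for \<open>x s\<close> to be within
      \<open>d\<close> of \<open>\<alpha>\<close>.\<close>
    define s where "s = min \<tau> (min (d' / 2) (d / (2 * (norm v + e))))"
    have "norm v + e > 0" using \<open>e > 0\<close> by (simp add: add_nonneg_pos)
    then have "s > 0" using \<open>\<tau> > 0\<close> \<open>d > 0\<close> \<open>d' > 0\<close> by (simp add: s_def)
    moreover have "s \<le> \<tau>" "s \<le> d' / 2" and "s \<le> d / (2 * (norm v + e))"
      unfolding s_def by linarith+
    moreover from this(3) have "s * (norm v + e) \<le> d / 2"
      using \<open>norm v + e > 0\<close> by (simp add: pos_le_divide_eq algebra_simps)
    ultimately have s: "s > 0" "s \<le> \<tau>" "s < d'" "s * (norm v + e) < d"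
      using \<open>d > 0\<close> \<open>d' > 0\<close> by linarith+
    define r where "r = x s - \<alpha> - s *\<^sub>R v"
    have r: "norm r \<le> e * s" using d'[of s] s x(2) by (auto simp: r_def)
    have xs: "x s - \<alpha> = s *\<^sub>R v + r" by (simp add: r_def)
    have le: "norm (x s - \<alpha>) \<le> s * (norm v + e)"
      using norm_triangle_ineq[of "s *\<^sub>R v" r] r s by (simp add: xs algebra_simps)
    have "ereal (\<eta> \<bullet> (x s - \<alpha>) - e * norm (x s - \<alpha>)) \<le> min_time F (\<alpha>, x s)"
      using d[of \<alpha> "x s"] le s by (simp add: dist_norm norm_Pair)
    also have "\<dots> \<le> ereal s"
      using min_time_le[of F s x] trajectory_on_subset[OF x(1), of "{0..s}"] s x(2) by auto
    finally have "\<eta> \<bullet> (x s - \<alpha>) \<le> s + e * norm (x s - \<alpha>)" by simp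
    also have "\<dots> \<le> s + e * (s * (norm v + e))"
      using le \<open>e > 0\<close> by (intro add_left_mono mult_left_mono) auto
    finally have "- (s * (v \<bullet> \<zeta>)) - \<zeta> \<bullet> r \<le> s + e * (s * (norm v + e))"
      by (simp add: eq xs inner_add_right inner_commute)
    moreover have "\<zeta> \<bullet> r \<le> norm \<zeta> * (e * s)"
      using norm_cauchy_schwarz[of \<zeta> r] mult_left_mono[OF r, of "norm \<zeta>"] by simp
    ultimately have "s * (- (v \<bullet> \<zeta>)) \<le> s * (1 + e * (norm \<zeta> + (norm v + e)))"
      by (simp add: algebra_simps)
    with s(1) show ?thesis by (simp only: mult_le_cancel_left_pos)
  qed
  note bound = this
  have "((\<lambda>e. 1 + e * (norm \<zeta> + (norm v + e))) \<longlongrightarrow> 1 + 0 * (norm \<zeta> + (norm v + 0))) (at_right 0)"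
    by (intro tendsto_intros)
  then have "- (v \<bullet> \<zeta>) \<le> 1 + 0 * (norm \<zeta> + (norm v + 0))"
    by (rule tendsto_lowerbound) (auto intro!: eventually_at_rightI[of 0 1] bound)
  then show "- 1 \<le> v \<bullet> \<zeta>" by simp
qed

lemma frechet_subdifferential_min_time_diagI:
  fixes F :: "'a::euclidean_space \<Rightarrow> 'a set"
  assumes F: "F2 F" "F3 F" and h: "\<And>v. v \<in> F \<alpha> \<Longrightarrow> - 1 \<le> v \<bullet> \<zeta>"
  shows "(\<zeta>, - \<zeta>) \<in> frechet_subdifferential (min_time F) (\<alpha>, \<alpha>)"
proof -
  let ?K = "cball \<alpha> 1"
  obtain L where "L > 0" and L: "\<And>x y u. x \<in> ?K \<Longrightarrow> y \<in> ?K \<Longrightarrow> u \<in> F x \<Longrightarrow> \<exists>w\<in>F y. dist u w \<le> L * dist x y"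
    using F2_compact[OF \<open>F2 F\<close> compact_cball] by metis
  obtain M where "M > 0" and M: "\<And>x v. x \<in> ?K \<Longrightarrow> v \<in> F x \<Longrightarrow> norm v \<le> M"
    using F3_compact_bound[OF \<open>F3 F\<close> compact_cball] by metis
  \<comment> \<open>For \<open>\<tau> \<ge> C * r\<close> the bound
    \<open>2 * norm \<zeta> * r\<close> on the linear term already suffices; the summand 1 keeps
    \<open>C\<close> positive.\<close>
  define C where "C = 2 * norm \<zeta> + 1"
  have "C > 0" by (simp add: C_def add_nonneg_pos)
  have "\<forall>\<^sub>F p in at (\<alpha>, \<alpha>). ereal ((\<zeta>, - \<zeta>) \<bullet> (p - (\<alpha>, \<alpha>)) - \<epsilon> * norm (p - (\<alpha>, \<alpha>))) \<le> min_time F p"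
    if "\<epsilon> > 0" for \<epsilon>
  proof -
    \<comment> \<open>The bound 1 stays where \<open>L\<close> and \<open>M\<close> are valid; the
      other one brings the velocity error \<open>L * \<delta> * norm \<zeta>\<close>, integrated
      over a time below \<open>C * r\<close>, under \<open>\<epsilon> * r\<close>.\<close>
    define \<delta> where "\<delta> = min 1 (\<epsilon> / (L * C * C))"
    have \<delta>: "\<delta> > 0" "\<delta> \<le> 1" "L * C * C * \<delta> \<le> \<epsilon>"
      using \<open>L > 0\<close> \<open>C > 0\<close> \<open>\<epsilon> > 0\<close> by (auto simp: \<delta>_def min_def field_simps)
    \<comment> \<open>A trajectory of duration below \<open>C * r\<close> starts within
      \<open>r\<close> of \<open>\<alpha>\<close> and travels at most \<open>M * C * r\<close>, so
      \<open>r < \<rho>\<close> keeps it in the ball of radius \<open>\<delta>\<close>.\<close>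
    define \<rho> where "\<rho> = \<delta> / (1 + M * C)"
    have "1 + M * C > 0" using \<open>M > 0\<close> \<open>C > 0\<close> by (simp add: add_pos_pos)
    then have \<rho>: "\<rho> > 0" "\<rho> * (1 + M * C) = \<delta>" using \<delta> by (auto simp: \<rho>_def)
    have "ereal ((\<zeta>, - \<zeta>) \<bullet> (p - (\<alpha>, \<alpha>)) - \<epsilon> * norm (p - (\<alpha>, \<alpha>))) \<le> min_time F p"
      if p: "dist p (\<alpha>, \<alpha>) < \<rho>" for p
    proof -
      obtain y z where yz: "p = (y, z)" by fastforce
      define r where "r = norm (p - (\<alpha>, \<alpha>))"
      have r: "norm (y - \<alpha>) \<le> r" "norm (z - \<alpha>) \<le> r" "r < \<rho>" "r \<ge> 0"
        using norm_fst_le[of "y - \<alpha>" "z - \<alpha>"] norm_snd_le[of "z - \<alpha>" "y - \<alpha>"] p by (auto simp: r_def yz dist_norm)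
      have inner_eq: "(\<zeta>, - \<zeta>) \<bullet> (p - (\<alpha>, \<alpha>)) = \<zeta> \<bullet> (y - z)"
        by (simp add: yz algebra_simps)
      have "\<zeta> \<bullet> (y - z) - \<epsilon> * r \<le> \<tau>" if x: "trajectory_on F {0..\<tau>} x" "x 0 = y" "x \<tau> = z" and "0 \<le> \<tau>" for \<tau> x
      proof (cases "C * r \<le> \<tau>")
        case True
        have "\<zeta> \<bullet> (y - z) \<le> norm \<zeta> * norm ((y - \<alpha>) - (z - \<alpha>))"
          using norm_cauchy_schwarz[of \<zeta> "y - z"] by simp
        also have "\<dots> \<le> norm \<zeta> * (r + r)"
          using norm_triangle_ineq4[of "y - \<alpha>" "z - \<alpha>"] r by (intro mult_left_mono) auto
        also have "\<dots> \<le> C * r" using r by (simp add: C_def algebra_simps)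
        finally show ?thesis using True \<open>\<epsilon> > 0\<close> r(4) mult_nonneg_nonneg[of \<epsilon> r] by linarith
      next
        case False
        have stay: "x t \<in> ball \<alpha> \<delta>" if "t \<in> {0..\<tau>}" for t
        proof (rule trajectory_stays_in_ball[OF x(1) _ _ _ that])
          show "norm v \<le> M" if "u \<in> ball \<alpha> \<delta>" "v \<in> F u" for u v
            using M[of u v] that \<delta> by auto
          have "dist \<alpha> (x 0) + M * \<tau> \<le> r + M * (C * r)"
            using r(1) x(2) False \<open>M > 0\<close>
            by (intro add_mono mult_left_mono) (auto simp: dist_norm norm_minus_commute)
          also have "\<dots> = r * (1 + M * C)" by (simp add: algebra_simps)
          also have "\<dots> < \<rho> * (1 + M * C)" using r \<open>1 + M * C > 0\<close> by simp
          finally show "dist \<alpha> (x 0) + M * \<tau> < \<delta>" using \<rho> by simp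
        qed (use \<open>M > 0\<close> in simp)
        have "- (1 + L * \<delta> * norm \<zeta>) * (\<tau> - 0) \<le> (x \<tau> - x 0) \<bullet> \<zeta>"
        proof (rule abs_continuous_inner_increment_ge[OF \<open>0 \<le> \<tau>\<close>])
          show "abs_continuous_on {0..\<tau>} x" using x by (simp add: trajectory_on_def)
          \<comment> \<open>The Lipschitz property compares \<open>v\<close> with some
            \<open>w\<close> in \<open>F \<alpha>\<close>, for which \<open>h\<close> gives the
            bound -1.\<close>
          have lower: "- (1 + L * \<delta> * norm \<zeta>) \<le> v \<bullet> \<zeta>" if t: "t \<in> {0..\<tau>}" and v: "v \<in> F (x t)" for t v
          proof -
            have d: "dist (x t) \<alpha> \<le> \<delta>" using stay[OF t] by (simp add: dist_commute)
            then have "x t \<in> ?K" using \<delta> by (simp add: dist_commute)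
            then obtain w where w: "w \<in> F \<alpha>" "dist v w \<le> L * dist (x t) \<alpha>"
              using L[of "x t" \<alpha> v] v by auto
            have "(w - v) \<bullet> \<zeta> \<le> norm (w - v) * norm \<zeta>" by (rule norm_cauchy_schwarz)
            also have "\<dots> \<le> L * \<delta> * norm \<zeta>"
            proof (rule mult_right_mono)
              have "dist v w \<le> L * \<delta>"
                using w(2) mult_left_mono[OF d, of L] \<open>L > 0\<close> by linarith
              then show "norm (w - v) \<le> L * \<delta>" by (simp add: dist_norm norm_minus_commute)
            qed simp
            finally show ?thesis using h[OF w(1)] by (simp add: inner_diff_left)
          qed
          have "AE t in lebesgue. t \<in> {0..\<tau>} \<longrightarrow> (\<exists>v\<in>F (x t). (x has_vector_derivative v) (at t within {0..\<tau>}))"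
            using x(1) by (simp add: trajectory_on_def AE_restrict_space_iff)
          then have "AE t in lebesgue. t \<in> {0..\<tau>} \<longrightarrow> (\<exists>v. (x has_vector_derivative v) (at t within {0..\<tau>}) \<and>
              - (1 + L * \<delta> * norm \<zeta>) \<le> v \<bullet> \<zeta>)"
            by (rule eventually_mono) (use lower in blast)
          then show "AE t in lebesgue_on {0..\<tau>}. \<exists>v. (x has_vector_derivative v) (at t within {0..\<tau>}) \<and>
              - (1 + L * \<delta> * norm \<zeta>) \<le> v \<bullet> \<zeta>"
            by (simp add: AE_restrict_space_iff)
        qed
        then have "\<zeta> \<bullet> (y - z) \<le> \<tau> + L * \<delta> * norm \<zeta> * \<tau>"
          by (simp add: x algebra_simps inner_commute)
        also have "L * \<delta> * norm \<zeta> * \<tau> \<le> L * \<delta> * C * (C * r)"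
          using False \<open>L > 0\<close> \<delta> \<open>C > 0\<close> r \<open>0 \<le> \<tau>\<close> by (intro mult_mono) (auto simp: C_def)
        also have "\<dots> = (L * C * C * \<delta>) * r" by simp
        also have "\<dots> \<le> \<epsilon> * r" using \<delta> r by (intro mult_right_mono) auto
        finally show ?thesis by simp
      qed
      \<comment> \<open>The bound holds for every admissible duration and so passes to the infimum,
        which is \<open>\<infinity>\<close> if no trajectory joins the points.\<close>
      then show ?thesis
        unfolding inner_eq r_def[symmetric] unfolding min_time_def yz prod.case
        by (intro Inf_greatest) auto
    qed
    then show ?thesis
      unfolding eventually_at using \<rho>(1) by blast
  qed
  then show ?thesis
    by (subst frechet_subdifferential_zero_iff) (auto simp: min_time_diag min_time_nonneg)
qed

theorem theorem3p1:
  fixes F :: "real ^ 'n \<Rightarrow> (real ^ 'n) set"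
  assumes "F1 F" and "F2 F" and "F3 F"
  shows "\<forall>\<alpha>. frechet_subdifferential (min_time F) (\<alpha>, \<alpha>) = {(\<zeta>, - \<zeta>) | \<zeta>. hamiltonian F \<alpha> \<zeta> \<ge> -1}"
proof
  fix \<alpha>
  \<comment> \<open>The minimum is attained, so bounding it from below bounds every
    velocity.\<close>
  have h: "hamiltonian F \<alpha> \<zeta> \<ge> -1 \<longleftrightarrow> (\<forall>v\<in>F \<alpha>. - 1 \<le> v \<bullet> \<zeta>)" for \<zeta>
    using hamiltonian_attained[OF \<open>F1 F\<close>, of \<alpha> \<zeta>] by force
  show "frechet_subdifferential (min_time F) (\<alpha>, \<alpha>) = {(\<zeta>, - \<zeta>) | \<zeta>. hamiltonian F \<alpha> \<zeta> \<ge> -1}"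
    unfolding h
    using frechet_subdifferential_min_time_diagD[OF assms] frechet_subdifferential_min_time_diagI[OF assms(2,3)]
    by fast
qed

end
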